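(* Let $\mathfrak d\in\frac12\mathbb N$. On the set of $\mathfrak s\in\frac12\mathbb N$ with $\frac{\mathfrak d}2\le\mathfrak s<\mathfrak d-1$, the function $\Phi$ takes its minimum (i.e. $\Phi(\mathfrak s_0)\le\Phi(\mathfrak s)$ for every $\mathfrak s$ in this set) at the point $\mathfrak s=\mathfrak s_0$, with $\mathfrak t=\mathfrak d-\mathfrak s_0$, given by: (1) $\mathfrak s=\mathfrak t=\frac{\mathfrak d}2$ if $\mathfrak d\in\mathbb N$; (2) $\mathfrak s=\frac{\mathfrak d}2+\frac14$ and $\mathfrak t=\frac{\mathfrak d}2-\frac14$ if $\mathfrak d\in\frac12\mathbb N\setminus\mathbb N$.
   Context: $\frac12\mathbb N=\{n/2:n\in\mathbb N\}$, $\mathbb N=\{1,2,\dots\}$. $I_x(\alpha,\beta)$ denotes the regularized incomplete beta function (CDF of the Beta$(\alpha,\beta)$ distribution). For real $\mathfrak s,\mathfrak t>0$ the equipoint $e_{\mathfrak s,\mathfrak t}\in[0,1]$ is the unique number satisfying $I_{e_{\mathfrak s,\mathfrak t}}(\mathfrak s,\mathfrak t+1)+I_{e_{\mathfrak s,\mathfrak t}}(\mathfrak s+1,\mathfrak t)=1$. For fixed $\mathfrak d$ and $0<\mathfrak s<\mathfrak d$, $\Phi(\mathfrak s):=I_{e_{\mathfrak s,\mathfrak d-\mathfrak s}}(\mathfrak s,\mathfrak d-\mathfrak s+1)$. When the set of admissible $\mathfrak s$ is empty the statement is vacuous. *)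

theory Defs
  imports "HOL-Analysis.Analysis"
begin

definition half_nats :: "real set" where
  "half_nats = {real n / 2 | n :: nat. n \<ge> 1}"

text \<open>
  Regularized incomplete beta function \<open>I\<^sub>x(a,b)\<close>, meaningful for \<open>a, b > 0\<close> and
  \<open>0 \<le> x \<le> 1\<close>; it is only used in this range.  For \<open>a < 1\<close> or \<open>b < 1\<close> the density is
  unbounded near an endpoint; since \<open>0 powr c = 0\<close>, its value at that endpoint is \<open>0\<close>,
  which does not affect the integral.
\<close>

definition reg_inc_beta :: "real \<Rightarrow> real \<Rightarrow> real \<Rightarrow> real" where
  "reg_inc_beta x a b =
     integral {0..x} (\<lambda>u. u powr (a - 1) * (1 - u) powr (b - 1)) / Beta a b"

text \<open>
  For \<open>s, t > 0\<close> the left-hand side below is continuous and strictly increasing in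
  \<open>e\<close> from \<open>0\<close> to \<open>2\<close> on \<open>[0,1]\<close>, so the description is proper.
\<close>

definition equipoint :: "real \<Rightarrow> real \<Rightarrow> real" where
  "equipoint s t =
     (THE e. e \<in> {0..1} \<and> reg_inc_beta e s (t + 1) + reg_inc_beta e (s + 1) t = 1)"

definition Phi :: "real \<Rightarrow> real \<Rightarrow> real" where
  "Phi d s = reg_inc_beta (equipoint s (d - s)) s (d - s + 1)"

definition admissible :: "real \<Rightarrow> real set" where
  "admissible d = {s \<in> half_nats. d / 2 \<le> s \<and> s < d - 1}"

text \<open>
  \<open>f\<close> takes its minimum over \<open>S\<close> at \<open>s\<^sub>0\<close>.  Attainment includes \<open>s\<^sub>0 \<in> S\<close>; the
  statement is vacuous for empty \<open>S\<close>.
\<close>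

definition takes_min_at :: "(real \<Rightarrow> real) \<Rightarrow> real set \<Rightarrow> real \<Rightarrow> bool" where
  "takes_min_at f S s0 \<longleftrightarrow> (S \<noteq> {} \<longrightarrow> s0 \<in> S \<and> (\<forall>s\<in>S. f s0 \<le> f s))"

end

theory Submission
  imports Defs "HOL-Real_Asymp.Real_Asymp"
begin

text \<open>
  Write \<open>t = d - s\<close>. For integers \<open>s, t\<close>, let \<open>X\<close> be binomial with \<open>s + t\<close> trials and success
  probability \<open>u\<close>. Then \<open>I\<^sub>u(s, t + 1) = P(X \<ge> s)\<close> and \<open>I\<^sub>u(s + 1, t) = P(X > s)\<close>, and their
  difference is the mass \<open>b(u) = C u\<^sup>s (1 - u)\<^sup>t\<close> of the point \<open>s\<close>, where
  \<open>C = \<Gamma>(s + t + 1) / (\<Gamma>(s + 1) \<Gamma>(t + 1))\<close>. The formula for the difference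
  persists for real \<open>s, t > 1\<close>. At the equipoint \<open>e\<close> the two tails add up to \<open>1\<close>, so
  \<open>\<Phi>(s) = (1 + b(e)) / 2\<close> (\<open>Phi_eq\<close>), and masses at equipoints are what has to be compared.

  The mass \<open>b\<close> increases up to its mode \<open>s / (s + t)\<close> and decreases afterwards. For \<open>s \<ge> t > 1\<close>
  the equipoint does not exceed the mode (\<open>equipoint_le_mode\<close>, a version of Simmons' inequality
  for real parameters), and for \<open>s > t > 1\<close> it is at least \<open>(s + 1/2) / (s + t + 1)\<close>
  (\<open>mean_le_equipoint\<close>). The latter number is the mean, and \<open>e\<close> the median, of the equal mixture
  of the two beta distributions. Therefore \<open>b(e)\<close> is at least the mass at the mean for \<open>s > t\<close>,
  and in any case it is at most the mass at the mode.

  Along \<open>s + t = d\<close> the mass at the mean grows with \<open>s \<ge> d/2\<close>, at a rate that comes from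
  \<open>\<psi>'(z + 1/2) \<le> 1/z\<close> for the trigamma function \<open>\<psi>'\<close> (\<open>mean_log_growth\<close>). At \<open>s = d/2\<close> mean and
  mode coincide, which settles integral \<open>d\<close>. At \<open>s = d/2 + 1/4\<close> the logarithm of the mass at the
  mode exceeds that at the mean by a quantity of order \<open>1 / d\<^sup>3\<close> (\<open>mode_log_le_mean_log\<close>), while
  half a unit further, at the next admissible \<open>s\<close>, the logarithm of the mass at the mean is
  larger by at least \<open>1 / (d + 1)\<^sup>2\<close>. This settles the other case.
\<close>

section \<open>Binomial tails with real parameters\<close>

definition bin_weight :: "real \<Rightarrow> real \<Rightarrow> real \<Rightarrow> real" where
  "bin_weight s t u = u powr s * (1 - u) powr t"

text \<open>
  Up to the factor \<open>bin_coeff s t\<close>, the following two integrals are the probabilities of at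
  least \<open>s\<close>, respectively more than \<open>s\<close>, successes in \<open>s + t\<close> trials. Leaving the factor out
  gives both the same total mass and lets them differ by exactly \<open>bin_weight s t\<close>.
\<close>
definition weak_tail :: "real \<Rightarrow> real \<Rightarrow> real \<Rightarrow> real" where
  "weak_tail s t x = integral {0..x} (\<lambda>u. s * (u powr (s - 1) * (1 - u) powr t))"

definition strict_tail :: "real \<Rightarrow> real \<Rightarrow> real \<Rightarrow> real" where
  "strict_tail s t x = integral {0..x} (\<lambda>u. t * (u powr s * (1 - u) powr (t - 1)))"

text \<open>
  The binomial coefficient \<open>s + t\<close> over \<open>s\<close>.
\<close>
definition bin_coeff :: "real \<Rightarrow> real \<Rightarrow> real" where
  "bin_coeff s t = Gamma (s + t + 1) / (Gamma (s + 1) * Gamma (t + 1))"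

lemma bin_coeff_pos: "s > 0 \<Longrightarrow> t > 0 \<Longrightarrow> bin_coeff s t > 0"
  unfolding bin_coeff_def by (intro divide_pos_pos mult_pos_pos Gamma_real_pos) auto

lemma continuous_on_bin_weight [continuous_intros]:
  fixes s t :: real
  assumes "s > 0" "t > 0" "A \<subseteq> {0..1}"
  shows "continuous_on A (\<lambda>u. u powr s * (1 - u) powr t)"
proof (rule continuous_on_subset)
  show "continuous_on {0..1} (\<lambda>u. u powr s * (1 - u) powr t)"
    using assms by (intro continuous_intros continuous_on_powr') auto
qed fact

text \<open>
  The common factor of the derivatives of \<open>bin_weight\<close> and of both tails: in terms of it these
  are polynomials times the kernel, and identities between them become polynomial identities.
\<close>
definition bin_kernel :: "real \<Rightarrow> real \<Rightarrow> real \<Rightarrow> real" where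
  "bin_kernel s t u = u powr (s - 1) * (1 - u) powr (t - 1)"

lemma bin_kernel_mult:
  assumes "0 \<le> u" "u \<le> 1"
  shows "u powr (s - 1) * (1 - u) powr t = (1 - u) * bin_kernel s t u"
    and "u powr s * (1 - u) powr (t - 1) = u * bin_kernel s t u"
    and "bin_weight s t u = u * (1 - u) * bin_kernel s t u"
proof -
  have "u powr s = u * u powr (s - 1)" "(1 - u) powr t = (1 - u) * (1 - u) powr (t - 1)"
    using assms by (simp_all add: powr_mult_base)
  then show "u powr (s - 1) * (1 - u) powr t = (1 - u) * bin_kernel s t u"
    "u powr s * (1 - u) powr (t - 1) = u * bin_kernel s t u"
    "bin_weight s t u = u * (1 - u) * bin_kernel s t u"
    by (simp_all only: bin_kernel_def bin_weight_def mult_ac)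
qed

lemma bin_kernel_pos: "0 < u \<Longrightarrow> u < 1 \<Longrightarrow> bin_kernel s t u > 0"
  by (simp add: bin_kernel_def)

lemma DERIV_bin_weight:
  assumes u: "0 < u" "u < 1"
  shows "(bin_weight s t has_real_derivative (s - (s + t) * u) * bin_kernel s t u) (at u)"
proof -
  have "(bin_weight s t has_real_derivative
           s * (u powr (s - 1) * (1 - u) powr t) - t * (u powr s * (1 - u) powr (t - 1))) (at u)"
    unfolding bin_weight_def using u
    by (auto intro!: derivative_eq_intros simp: algebra_simps)
  then show ?thesis
    using u by (simp add: bin_kernel_mult algebra_simps)
qed

context
  fixes s t :: real
  assumes s: "s > 1" and t: "t > 1"
begin

lemma DERIV_weak_tail:
  assumes "0 < x" "x < 1"
  shows "(weak_tail s t has_real_derivative s * (1 - x) * bin_kernel s t x) (at x)"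
proof -
  have "((\<lambda>x. integral {0..x} (\<lambda>u. s * (u powr (s - 1) * (1 - u) powr t)))
          has_real_derivative s * (x powr (s - 1) * (1 - x) powr t)) (at x within {0..1})"
    using assms s t by (intro integral_has_real_derivative continuous_intros) auto
  then show ?thesis
    using assms by (simp add: at_within_Icc_at weak_tail_def[abs_def] bin_kernel_mult mult.assoc)
qed

lemma DERIV_strict_tail:
  assumes "0 < x" "x < 1"
  shows "(strict_tail s t has_real_derivative t * x * bin_kernel s t x) (at x)"
proof -
  have "((\<lambda>x. integral {0..x} (\<lambda>u. t * (u powr s * (1 - u) powr (t - 1))))
          has_real_derivative t * (x powr s * (1 - x) powr (t - 1))) (at x within {0..1})"
    using assms s t by (intro integral_has_real_derivative continuous_intros) auto
  then show ?thesis
    using assms by (simp add: at_within_Icc_at strict_tail_def[abs_def] bin_kernel_mult mult.assoc)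
qed

lemma continuous_on_weak_tail: "continuous_on {0..1} (weak_tail s t)"
  unfolding weak_tail_def[abs_def] using s t
  by (intro indefinite_integral_continuous_1 integrable_continuous_real continuous_intros) auto

lemma continuous_on_strict_tail: "continuous_on {0..1} (strict_tail s t)"
  unfolding strict_tail_def[abs_def] using s t
  by (intro indefinite_integral_continuous_1 integrable_continuous_real continuous_intros) auto

lemma tail_0 [simp]: "weak_tail s t 0 = 0" "strict_tail s t 0 = 0"
  by (simp_all add: weak_tail_def strict_tail_def)

lemma Beta_shift:
  "Beta s (t + 1) = 1 / (s * bin_coeff s t)" "Beta (s + 1) t = 1 / (t * bin_coeff s t)"
proof -
  have "Gamma (s + 1) = s * Gamma s" "Gamma (t + 1) = t * Gamma t"
    using s t by (auto intro!: Gamma_plus1 dest: nonpos_Ints_nonpos)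
  moreover have "Gamma s > 0" "Gamma t > 0" using s t by (auto intro!: Gamma_real_pos)
  ultimately show "Beta s (t + 1) = 1 / (s * bin_coeff s t)" "Beta (s + 1) t = 1 / (t * bin_coeff s t)"
    using s t unfolding Beta_def bin_coeff_def by (simp_all add: field_simps add_ac)
qed

lemma reg_inc_beta_weak: "reg_inc_beta x s (t + 1) = bin_coeff s t * weak_tail s t x"
  unfolding reg_inc_beta_def weak_tail_def Beta_shift by simp

lemma reg_inc_beta_strict: "reg_inc_beta x (s + 1) t = bin_coeff s t * strict_tail s t x"
  unfolding reg_inc_beta_def strict_tail_def Beta_shift by simp

lemma tail_1: "weak_tail s t 1 = 1 / bin_coeff s t" "strict_tail s t 1 = 1 / bin_coeff s t"
proof -
  have "((\<lambda>u. u powr (s - 1) * (1 - u) powr (t + 1 - 1)) has_integral Beta s (t + 1)) {0..1}"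
    using s t by (intro has_integral_Beta_real) auto
  from integral_unique[OF this] show "weak_tail s t 1 = 1 / bin_coeff s t"
    using s by (simp add: weak_tail_def Beta_shift)
  have "((\<lambda>u. u powr (s + 1 - 1) * (1 - u) powr (t - 1)) has_integral Beta (s + 1) t) {0..1}"
    using s t by (intro has_integral_Beta_real) auto
  from integral_unique[OF this] show "strict_tail s t 1 = 1 / bin_coeff s t"
    using t by (simp add: strict_tail_def Beta_shift)
qed

lemma continuous_on_bin_weight_Icc: "continuous_on {0..1} (bin_weight s t)"
  unfolding bin_weight_def[abs_def] using s t by (intro continuous_on_bin_weight) auto

lemma weak_minus_strict_tail:
  assumes x: "0 \<le> x" "x \<le> 1"
  shows "weak_tail s t x - strict_tail s t x = bin_weight s t x"
proof -
  let ?f = "\<lambda>x. weak_tail s t x - strict_tail s t x - bin_weight s t x"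
  have "?f x = ?f 0"
  proof (rule DERIV_isconst2[where a = 0 and b = 1])
    show "continuous_on {0..1} ?f"
      by (intro continuous_intros continuous_on_weak_tail continuous_on_strict_tail
          continuous_on_bin_weight_Icc)
    show "DERIV ?f u :> 0" if "0 < u" "u < 1" for u
      by (rule DERIV_cong[OF DERIV_diff[OF DERIV_diff[OF DERIV_weak_tail DERIV_strict_tail] DERIV_bin_weight]])
        (use that in \<open>auto simp: algebra_simps\<close>)
  qed (use x in auto)
  then show ?thesis
    using s by (simp add: bin_weight_def)
qed

lemma tail_sum_strict_mono:
  assumes "0 \<le> a" "a < b" "b \<le> 1"
  shows "weak_tail s t a + strict_tail s t a < weak_tail s t b + strict_tail s t b"
proof (rule DERIV_pos_imp_increasing_open[OF \<open>a < b\<close>])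
  show "\<exists>y. ((\<lambda>x. weak_tail s t x + strict_tail s t x) has_real_derivative y) (at x) \<and> y > 0"
    if "a < x" "x < b" for x
  proof (intro exI conjI)
    show "((\<lambda>x. weak_tail s t x + strict_tail s t x) has_real_derivative
        s * (1 - x) * bin_kernel s t x + t * x * bin_kernel s t x) (at x)"
      using assms that by (intro derivative_intros DERIV_weak_tail DERIV_strict_tail) auto
    show "s * (1 - x) * bin_kernel s t x + t * x * bin_kernel s t x > 0"
      using assms that s t by (intro add_pos_pos mult_pos_pos bin_kernel_pos) auto
  qed
  show "continuous_on {a..b} (\<lambda>x. weak_tail s t x + strict_tail s t x)"
    using assms by (intro continuous_intros continuous_on_subset[OF continuous_on_weak_tail]
        continuous_on_subset[OF continuous_on_strict_tail]) auto
qed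

text \<open>
  The sum of the tails climbs continuously and strictly from \<open>0\<close> to \<open>2 / bin_coeff s t\<close>, so the
  definite description of the equipoint has exactly one witness.
\<close>
lemma equipoint:
  shows equipoint_ge_0: "0 \<le> equipoint s t" and equipoint_le_1: "equipoint s t \<le> 1"
    and equipoint_eq: "weak_tail s t (equipoint s t) + strict_tail s t (equipoint s t) = 1 / bin_coeff s t"
proof -
  have C: "bin_coeff s t > 0" using s t by (intro bin_coeff_pos) auto
  let ?G = "\<lambda>x. weak_tail s t x + strict_tail s t x"
  have eq: "reg_inc_beta e s (t + 1) + reg_inc_beta e (s + 1) t = 1 \<longleftrightarrow> ?G e = 1 / bin_coeff s t" for e
    unfolding reg_inc_beta_weak reg_inc_beta_strict using C by (simp add: field_simps)
  have "continuous_on {0..1} ?G"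
    by (intro continuous_intros continuous_on_weak_tail continuous_on_strict_tail)
  then obtain e where e: "0 \<le> e" "e \<le> 1" "?G e = 1 / bin_coeff s t"
    using IVT'[of ?G 0 "1 / bin_coeff s t" 1] C by (auto simp: tail_1 divide_right_mono)
  have "\<exists>!e. e \<in> {0..1} \<and> reg_inc_beta e s (t + 1) + reg_inc_beta e (s + 1) t = 1"
  proof (rule ex1I[of _ e])
    show "e \<in> {0..1} \<and> reg_inc_beta e s (t + 1) + reg_inc_beta e (s + 1) t = 1"
      using e by (simp add: eq)
    show "e' = e" if "e' \<in> {0..1} \<and> reg_inc_beta e' s (t + 1) + reg_inc_beta e' (s + 1) t = 1" for e'
      using that e tail_sum_strict_mono[of e e'] tail_sum_strict_mono[of e' e]
      by (fastforce simp: eq)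
  qed
  from theI'[OF this, folded equipoint_def] show "0 \<le> equipoint s t" "equipoint s t \<le> 1"
    "weak_tail s t (equipoint s t) + strict_tail s t (equipoint s t) = 1 / bin_coeff s t"
    unfolding eq by auto
qed

lemma equipoint_geI:
  assumes "0 \<le> x" "x \<le> 1" "weak_tail s t x + strict_tail s t x \<le> 1 / bin_coeff s t"
  shows "x \<le> equipoint s t"
  using assms tail_sum_strict_mono[of "equipoint s t" x] equipoint by force

lemma equipoint_leI:
  assumes "0 \<le> x" "x \<le> 1" "weak_tail s t x + strict_tail s t x \<ge> 1 / bin_coeff s t"
  shows "equipoint s t \<le> x"
  using assms tail_sum_strict_mono[of x "equipoint s t"] equipoint by force

text \<open>
  The equipoint fixes the sum of the two tails and \<open>bin_weight\<close> is their difference, hence each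
  tail is known in terms of the weight alone.
\<close>
lemma Phi_eq: "Phi (s + t) s = (1 + bin_coeff s t * bin_weight s t (equipoint s t)) / 2"
proof -
  have C: "bin_coeff s t > 0" using s t by (intro bin_coeff_pos) auto
  have "2 * weak_tail s t (equipoint s t) = 1 / bin_coeff s t + bin_weight s t (equipoint s t)"
    using weak_minus_strict_tail[of "equipoint s t"] equipoint by simp
  then show ?thesis
    using C by (simp add: Phi_def reg_inc_beta_weak) (simp add: field_simps)
qed

lemma bin_weight_mono:
  assumes "0 \<le> a" "a \<le> b" "b \<le> s / (s + t)"
  shows "bin_weight s t a \<le> bin_weight s t b"
proof (rule DERIV_nonneg_imp_increasing_open[OF \<open>a \<le> b\<close>])
  have b: "s / (s + t) < 1" using s t by simp
  show "\<exists>y. (bin_weight s t has_real_derivative y) (at x) \<and> y \<ge> 0" if "a < x" "x < b" for x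
  proof (intro exI conjI, rule DERIV_bin_weight)
    show x: "0 < x" "x < 1" using assms that b by auto
    have "x \<le> s / (s + t)" using assms that by simp
    then have "s - (s + t) * x \<ge> 0" using s t by (simp add: field_simps)
    then show "(s - (s + t) * x) * bin_kernel s t x \<ge> 0"
      using bin_kernel_pos[OF x, of s t] by simp
  qed
  show "continuous_on {a..b} (bin_weight s t)"
    using assms b by (intro continuous_on_subset[OF continuous_on_bin_weight_Icc]) auto
qed

lemma bin_weight_antimono:
  assumes "s / (s + t) \<le> a" "a \<le> b" "b \<le> 1"
  shows "bin_weight s t b \<le> bin_weight s t a"
proof (rule DERIV_nonpos_imp_decreasing_open[OF \<open>a \<le> b\<close>])
  have a: "s / (s + t) > 0" using s t by simp
  show "\<exists>y. (bin_weight s t has_real_derivative y) (at x) \<and> y \<le> 0" if "a < x" "x < b" for x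
  proof (intro exI conjI, rule DERIV_bin_weight)
    show x: "0 < x" "x < 1" using assms that a by auto
    have "x \<ge> s / (s + t)" using assms that by simp
    then have "s - (s + t) * x \<le> 0" using s t by (simp add: field_simps)
    then show "(s - (s + t) * x) * bin_kernel s t x \<le> 0"
      using bin_kernel_pos[OF x, of s t] by (simp add: mult_nonpos_nonneg)
  qed
  show "continuous_on {a..b} (bin_weight s t)"
    using assms a by (intro continuous_on_subset[OF continuous_on_bin_weight_Icc]) auto
qed

lemma bin_weight_le_mode:
  assumes "0 \<le> u" "u \<le> 1"
  shows "bin_weight s t u \<le> bin_weight s t (s / (s + t))"
  using assms bin_weight_mono[of u "s / (s + t)"] bin_weight_antimono[of "s / (s + t)" u] by linarith

end

section \<open>The equipoint does not exceed the mode\<close>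

context
  fixes s t x y :: real
  assumes t: "t > 1" and ts: "t \<le> s"
  defines "x \<equiv> s / (s + t)" and "y \<equiv> t / (s + t)"
begin

text \<open>
  The claim is \<open>weak_tail x \<ge> total - strict_tail x\<close> at the mode \<open>x\<close>. The left side integrates
  over points left of \<open>x\<close>, the right side over points right of \<open>x\<close>. With \<open>w\<close> for the weight,
  both are integrals against the variation \<open>\<bar>dw\<bar>\<close>, with densities \<open>s (1 - u) / (s - (s + t) u)\<close>
  on the left and \<open>t u / ((s + t) u - s)\<close> on the right, which decrease from infinity to \<open>1\<close> with
  the distance from \<open>x\<close>. The curves \<open>lo\<close> and \<open>hi\<close> parametrise the two sides by the common value
  \<open>1 + k x y\<close> of these densities, so that \<open>k = 0\<close> gives the endpoints \<open>0\<close> and \<open>1\<close> and \<open>k \<rightarrow> \<infinity>\<close>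
  gives \<open>x\<close>. The inequality then reduces to a comparison of \<open>w\<close> at points with equal density.
\<close>
private definition lo where "lo k = k * x\<^sup>2 / (1 + k * x)"
private definition hi where "hi k = (1 + k * x * y) / (1 + k * y)"

private lemma mode_coords: "0 < x" "0 < y" "x + y = 1" "y \<le> x" "x < 1" "s = (s + t) * x" "t = (s + t) * y"
  using t ts unfolding x_def y_def by (simp_all add: divide_simps)

private lemma path:
  assumes k: "k \<ge> 0"
  shows "1 - lo k = (1 + k * x * y) / (1 + k * x)" "1 - hi k = k * y\<^sup>2 / (1 + k * y)"
    "s - (s + t) * lo k = (s + t) * x / (1 + k * x)" "s - (s + t) * hi k = - ((s + t) * y / (1 + k * y))"
proof -
  have p: "1 + k * x > 0" "1 + k * y > 0" using k mode_coords by (auto intro: add_pos_nonneg)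
  have y: "y = 1 - x" using mode_coords by simp
  show 1: "1 - lo k = (1 + k * x * y) / (1 + k * x)"
    using p(1) by (simp add: lo_def y field_simps power2_eq_square)
  show 2: "1 - hi k = k * y\<^sup>2 / (1 + k * y)"
    using p(2) unfolding hi_def by (simp add: y divide_simps) (simp add: algebra_simps power2_eq_square)
  have "x - lo k = x / (1 + k * x)"
    using p(1) by (simp add: lo_def field_simps power2_eq_square)
  then have "(s + t) * (x - lo k) = (s + t) * (x / (1 + k * x))" by simp
  then show "s - (s + t) * lo k = (s + t) * x / (1 + k * x)"
    using mode_coords(6) by (simp add: right_diff_distrib)
  have "x - hi k = - (y / (1 + k * y))"
    using p(2) unfolding hi_def by (simp add: y divide_simps) (simp add: algebra_simps)
  then have "(s + t) * (x - hi k) = (s + t) * (- (y / (1 + k * y)))" by simp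
  then show "s - (s + t) * hi k = - ((s + t) * y / (1 + k * y))"
    using mode_coords(6) by (simp add: right_diff_distrib)
qed

private lemma path_range:
  assumes k: "k > 0"
  shows "0 < lo k" "lo k < 1" "0 < hi k" "hi k < 1"
proof -
  have p: "1 + k * x > 0" "1 + k * y > 0" "1 + k * x * y > 0" 
    using k mode_coords by (auto intro!: add_pos_nonneg)
  have "1 - lo k > 0" "1 - hi k > 0" using path[of k] p k mode_coords by auto
  moreover show "0 < lo k" "0 < hi k" using p k mode_coords by (auto simp: lo_def hi_def)
  ultimately show "lo k < 1" "hi k < 1" by auto
qed

private lemma DERIV_path:
  assumes k: "k \<ge> 0"
  shows "(lo has_real_derivative (x / (1 + k * x))\<^sup>2) (at k)"
    "(hi has_real_derivative - (y / (1 + k * y))\<^sup>2) (at k)"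
proof -
  have p: "1 + k * x > 0" "1 + k * y > 0" using k mode_coords by (auto intro: add_pos_nonneg)
  have y: "y = 1 - x" using mode_coords by simp
  show "(lo has_real_derivative (x / (1 + k * x))\<^sup>2) (at k)"
    unfolding lo_def[abs_def] using p(1)
    by (auto intro!: derivative_eq_intros simp: power2_eq_square divide_simps) (simp add: algebra_simps)
  have "(hi has_real_derivative (x * y * (1 + k * y) - (1 + k * x * y) * y) / (1 + k * y)\<^sup>2) (at k)"
    unfolding hi_def[abs_def] using p(2)
    by (auto intro!: derivative_eq_intros simp: power2_eq_square)
  moreover have "x * y * (1 + k * y) - (1 + k * x * y) * y = - y\<^sup>2"
    by (simp add: y power2_eq_square algebra_simps)
  ultimately show "(hi has_real_derivative - (y / (1 + k * y))\<^sup>2) (at k)"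
    by (simp add: power_divide)
qed

private lemma path_tendsto: "(lo \<longlongrightarrow> x) at_top" "(hi \<longlongrightarrow> x) at_top"
proof -
  have "((\<lambda>k. k * (x * x) / (1 + k * x)) \<longlongrightarrow> x) at_top"
    using mode_coords(1) by real_asymp
  then show "(lo \<longlongrightarrow> x) at_top" by (simp add: lo_def[abs_def] power2_eq_square)
  have "((\<lambda>k. (1 + k * x * y) / (1 + k * y)) \<longlongrightarrow> x) at_top"
    using mode_coords(1,2) by real_asymp
  then show "(hi \<longlongrightarrow> x) at_top" by (simp add: hi_def[abs_def])
qed

private lemma s_gt_1: "s > 1" using t ts by simp

private lemma bin_weight_pos: "0 < u \<Longrightarrow> u < 1 \<Longrightarrow> bin_weight s t u > 0"
  by (simp add: bin_weight_def)

text \<open>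
  In terms of \<open>k\<close>, the logarithmic derivatives of the weight along \<open>lo\<close> and \<open>hi\<close> are
  \<open>(s + t) x / (k (1 + k x) (1 + k x y))\<close> and the same with \<open>y\<close> for the first two \<open>x\<close>. As
  \<open>x \<ge> y\<close>, the ratio of the two weights is monotone in \<open>k\<close>, and it tends to \<open>1\<close> since both
  curves run into the mode.
\<close>
private lemma bin_weight_lo_le_hi:
  assumes k: "k > 0"
  shows "bin_weight s t (lo k) \<le> bin_weight s t (hi k)"
proof -
  define f where "f k = ln (bin_weight s t (hi k)) - ln (bin_weight s t (lo k))" for k
  have D: "(f has_real_derivative
      (s + t) * (y / (1 + k * y) - x / (1 + k * x)) / (k * (1 + k * x * y))) (at k)" if k: "k > 0" for k
  proof -
    have p: "1 + k * x > 0" "1 + k * y > 0" "1 + k * x * y > 0"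
      using k mode_coords by (auto intro!: add_pos_nonneg)
    have lnw: "((\<lambda>k. ln (bin_weight s t (v k))) has_real_derivative
        (s - (s + t) * v k) / (v k * (1 - v k)) * v') (at k)"
      if v: "0 < v k" "v k < 1" "(v has_real_derivative v') (at k)" for v v'
    proof -
      have b: "bin_weight s t (v k) > 0" using v by (simp add: bin_weight_pos)
      have "((\<lambda>k. ln (bin_weight s t (v k))) has_real_derivative
          1 / bin_weight s t (v k) * ((s - (s + t) * v k) * bin_kernel s t (v k) * v')) (at k)"
        by (rule DERIV_cong[OF DERIV_chain2[OF DERIV_ln_divide[OF b]
              DERIV_chain2[OF DERIV_bin_weight[OF v(1,2)] v(3)]]]) simp
      moreover have "1 / bin_weight s t (v k) * ((s - (s + t) * v k) * bin_kernel s t (v k) * v')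
          = (s - (s + t) * v k) / (v k * (1 - v k)) * v'"
        using v bin_kernel_pos[OF v(1,2), of s t] by (simp add: bin_kernel_mult(3))
      ultimately show ?thesis by simp
    qed
    note r = path_range[OF k]
    have k0: "k \<ge> 0" using k by simp
    have "(f has_real_derivative (s - (s + t) * hi k) / (hi k * (1 - hi k)) * - (y / (1 + k * y))\<^sup>2
        - (s - (s + t) * lo k) / (lo k * (1 - lo k)) * (x / (1 + k * x))\<^sup>2) (at k)"
      unfolding f_def[abs_def] by (intro DERIV_diff lnw r DERIV_path k0)
    moreover have "(s - (s + t) * hi k) / (hi k * (1 - hi k)) * - (y / (1 + k * y))\<^sup>2
        = (s + t) * (y / (1 + k * y)) / (k * (1 + k * x * y))"
      unfolding path[OF k0] unfolding hi_def using p k mode_coords(1,2)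
      by (simp add: divide_simps) (simp add: power2_eq_square)
    moreover have "(s - (s + t) * lo k) / (lo k * (1 - lo k)) * (x / (1 + k * x))\<^sup>2
        = (s + t) * (x / (1 + k * x)) / (k * (1 + k * x * y))"
      unfolding path[OF k0] unfolding lo_def using p k mode_coords(1,2)
      by (simp add: divide_simps) (simp add: power2_eq_square)
    ultimately show ?thesis
      by (simp add: right_diff_distrib diff_divide_distrib)
  qed
  have "f k' \<le> f k" if k': "k \<le> k'" for k'
  proof (rule DERIV_nonpos_imp_nonincreasing[OF k'])
    fix l assume l: "k \<le> l" "l \<le> k'"
    then have l0: "l > 0" using k by simp
    have p: "1 + l * x > 0" "1 + l * y > 0" "1 + l * x * y > 0"
      using l0 mode_coords by (auto intro!: add_pos_nonneg)
    have "y / (1 + l * y) - x / (1 + l * x) = (y - x) / ((1 + l * y) * (1 + l * x))"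
      using p by (simp add: divide_simps) (simp add: algebra_simps)
    also have "\<dots> \<le> 0" using mode_coords p by (intro divide_nonpos_pos) auto
    finally have "(s + t) * (y / (1 + l * y) - x / (1 + l * x)) / (l * (1 + l * x * y)) \<le> 0"
      using p s_gt_1 t l0 by (intro divide_nonpos_pos mult_nonneg_nonpos mult_pos_pos) auto
    then show "\<exists>y. (f has_real_derivative y) (at l) \<and> y \<le> 0" using D[OF l0] by blast
  qed
  moreover have "(f \<longlongrightarrow> ln (bin_weight s t x) - ln (bin_weight s t x)) at_top"
    unfolding f_def[abs_def] bin_weight_def using mode_coords
    by (intro tendsto_intros path_tendsto) auto
  ultimately have "f k \<ge> 0"
    by (intro tendsto_upperbound[of f 0 at_top]) (auto simp: eventually_at_top_linorder)
  then show ?thesis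
    using path_range[OF k] bin_weight_pos by (simp add: f_def)
qed

text \<open>
  The factor \<open>1 + k x y\<close> grows only like the inverse distance of the curves from the mode, where
  the derivative of the weight vanishes.
\<close>
private lemma gap_tendsto_0: "((\<lambda>k. (1 + k * x * y) * (bin_weight s t (lo k) - bin_weight s t (hi k))) \<longlongrightarrow> 0) at_top"
proof -
  define q where "q u = (bin_weight s t u - bin_weight s t x) / (u - x)" for u
  have "(bin_weight s t has_real_derivative 0) (at x)"
    using DERIV_bin_weight[of x s t] mode_coords by simp
  then have q: "(q \<longlongrightarrow> 0) (at x)"
    by (simp add: has_field_derivative_iff q_def[abs_def])
  have bd: "((\<lambda>k. (1 + k * x * y) * (v k - x) * q (v k)) \<longlongrightarrow> c * 0) at_top"
    if v: "(v \<longlongrightarrow> x) at_top" "\<And>k. k > 0 \<Longrightarrow> v k \<noteq> x"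
      and c: "((\<lambda>k. (1 + k * x * y) * (v k - x)) \<longlongrightarrow> c) at_top" for v c
  proof (intro tendsto_mult c)
    have "filterlim v (at x) at_top"
      using v by (auto simp: filterlim_at intro!: eventually_mono[OF eventually_gt_at_top[of 0]])
    then show "((\<lambda>k. q (v k)) \<longlongrightarrow> 0) at_top" by (rule filterlim_compose[OF q])
  qed
  have e: "lo k - x = - x / (1 + k * x)" "hi k - x = y / (1 + k * y)" if "k > 0" for k
  proof -
    have "(s + t) * (x - lo k) = (s + t) * (x / (1 + k * x))"
      "(s + t) * (x - hi k) = (s + t) * (- (y / (1 + k * y)))"
      using path(3,4)[of k] that mode_coords(6) by (simp_all add: right_diff_distrib)
    then have "x - lo k = x / (1 + k * x)" "x - hi k = - (y / (1 + k * y))"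
      using s_gt_1 t unfolding mult_cancel_left by auto
    then show "lo k - x = - x / (1 + k * x)" "hi k - x = y / (1 + k * y)" by auto
  qed
  have ne: "lo k \<noteq> x" "hi k \<noteq> x" if "k > 0" for k
  proof -
    have "1 + k * x > 0" "1 + k * y > 0" using that mode_coords by (auto intro: add_pos_nonneg)
    then have "lo k - x \<noteq> 0" "hi k - x \<noteq> 0" unfolding e[OF that] using mode_coords by auto
    then show "lo k \<noteq> x" "hi k \<noteq> x" by auto
  qed
  have "((\<lambda>k. (1 + k * x * y) * (- x / (1 + k * x))) \<longlongrightarrow> - (x * y)) at_top"
    "((\<lambda>k. (1 + k * x * y) * (y / (1 + k * y))) \<longlongrightarrow> x * y) at_top"
    using mode_coords(1,2) by (real_asymp)+
  then have c: "((\<lambda>k. (1 + k * x * y) * (lo k - x)) \<longlongrightarrow> - (x * y)) at_top"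
    "((\<lambda>k. (1 + k * x * y) * (hi k - x)) \<longlongrightarrow> x * y) at_top"
    by (auto elim!: Lim_transform_eventually intro!: eventually_mono[OF eventually_gt_at_top[of 0]] simp: e)
  have "((\<lambda>k. (1 + k * x * y) * (lo k - x) * q (lo k) - (1 + k * x * y) * (hi k - x) * q (hi k))
      \<longlongrightarrow> - (x * y) * 0 - x * y * 0) at_top"
    by (intro tendsto_diff bd path_tendsto ne c)
  moreover have "eventually (\<lambda>k. (1 + k * x * y) * (lo k - x) * q (lo k) - (1 + k * x * y) * (hi k - x) * q (hi k)
      = (1 + k * x * y) * (bin_weight s t (lo k) - bin_weight s t (hi k))) at_top"
  proof (rule eventually_mono[OF eventually_gt_at_top[of 0]])
    fix k :: real assume k: "k > 0"
    have "(v - x) * q v = bin_weight s t v - bin_weight s t x" if "v \<noteq> x" for v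
      using that by (simp add: q_def)
    from this[OF ne(1)[OF k]] this[OF ne(2)[OF k]]
    show "(1 + k * x * y) * (lo k - x) * q (lo k) - (1 + k * x * y) * (hi k - x) * q (hi k)
      = (1 + k * x * y) * (bin_weight s t (lo k) - bin_weight s t (hi k))"
      by (simp only: mult.assoc[of "1 + k * x * y"]) (simp add: right_diff_distrib)
  qed
  ultimately show ?thesis by (auto elim: Lim_transform_eventually)
qed

text \<open>
  Integration by parts along the two curves, where the density is \<open>1 + k x y\<close> on both sides,
  turns the difference of the two integrals up to \<open>k\<close> into a boundary term plus \<open>x y\<close> times the
  integral of \<open>w(hi) - w(lo) \<ge> 0\<close>. The function \<open>J\<close> is the difference without its boundary term.
\<close>
lemma equipoint_le_mode: "equipoint s t \<le> x"
proof -
  define J where "J k = weak_tail s t (lo k) + strict_tail s t (hi k) - strict_tail s t 1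
      - (1 + k * x * y) * (bin_weight s t (lo k) - bin_weight s t (hi k))" for k
  have J0: "J 0 = 0"
    using s_gt_1 t by (simp add: J_def lo_def hi_def bin_weight_def)
  have J: "J k \<ge> 0" if k: "k > 0" for k
  proof -
    have r: "lo l \<in> {0..1}" "hi l \<in> {0..1}" if "l \<ge> 0" for l
      using path_range[of l] that by (cases "l = 0"; force simp: lo_def hi_def)+
    have im: "lo ` {0..k} \<subseteq> {0..1}" "hi ` {0..k} \<subseteq> {0..1}"
      by (intro image_subsetI r; simp)+
    have cu: "continuous_on {0..k} lo" "continuous_on {0..k} hi"
      by (intro DERIV_continuous_on[OF has_field_derivative_at_within, OF DERIV_path(1)]
          DERIV_continuous_on[OF has_field_derivative_at_within, OF DERIV_path(2)]; simp)+
    have "J 0 \<le> J k"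
    proof (rule DERIV_nonneg_imp_increasing_open[of 0 k J])
      show "0 \<le> k" using k by simp
      have "continuous_on {0..k} (\<lambda>l. weak_tail s t (lo l))" "continuous_on {0..k} (\<lambda>l. strict_tail s t (hi l))"
        "continuous_on {0..k} (\<lambda>l. bin_weight s t (lo l))" "continuous_on {0..k} (\<lambda>l. bin_weight s t (hi l))"
        by (rule continuous_on_compose2[OF continuous_on_weak_tail[OF s_gt_1 t] cu(1) im(1)],
            rule continuous_on_compose2[OF continuous_on_strict_tail[OF s_gt_1 t] cu(2) im(2)],
            rule continuous_on_compose2[OF continuous_on_bin_weight_Icc[OF s_gt_1 t] cu(1) im(1)],
            rule continuous_on_compose2[OF continuous_on_bin_weight_Icc[OF s_gt_1 t] cu(2) im(2)])
      then show "continuous_on {0..k} J"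
        unfolding J_def[abs_def]
        by (intro continuous_on_diff continuous_on_add continuous_on_mult continuous_on_const continuous_on_id)
      fix l assume l: "0 < l" "l < k"
      then have l0: "l \<ge> 0" by simp
      note r = path_range[OF l(1)]
      have p: "1 + l * x > 0" "1 + l * y > 0" "1 + l * x * y > 0"
        using l0 mode_coords by (auto intro!: add_pos_nonneg)
      note D1 = DERIV_path(1)[OF l0] and D2 = DERIV_path(2)[OF l0]
      have e1: "s * (1 - lo l) = (1 + l * x * y) * (s - (s + t) * lo l)"
        unfolding path[OF l0] using mode_coords(6) by simp
      have e2: "t * hi l = - ((1 + l * x * y) * (s - (s + t) * hi l))"
        unfolding path[OF l0] unfolding hi_def using mode_coords(7) by simp
      let ?lo' = "(x / (1 + l * x))\<^sup>2" and ?hi' = "- (y / (1 + l * y))\<^sup>2"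
      have "(J has_real_derivative
          s * (1 - lo l) * bin_kernel s t (lo l) * ?lo' + t * hi l * bin_kernel s t (hi l) * ?hi' - 0
          - (x * y * (bin_weight s t (lo l) - bin_weight s t (hi l))
             + (1 + l * x * y) * ((s - (s + t) * lo l) * bin_kernel s t (lo l) * ?lo'
                 - (s - (s + t) * hi l) * bin_kernel s t (hi l) * ?hi'))) (at l)"
        unfolding J_def[abs_def]
        by (intro DERIV_diff DERIV_add DERIV_const
            DERIV_chain2[OF DERIV_weak_tail[OF s_gt_1 t r(1,2)] D1]
            DERIV_chain2[OF DERIV_strict_tail[OF s_gt_1 t r(3,4)] D2]
            DERIV_cong[OF DERIV_mult[OF _ DERIV_diff[OF DERIV_chain2[OF DERIV_bin_weight[OF r(1,2)] D1]
               DERIV_chain2[OF DERIV_bin_weight[OF r(3,4)] D2]]]])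
          (auto intro!: derivative_eq_intros)
      \<comment> \<open>Equality of the densities makes everything cancel but the derivative of \<open>1 + k x y\<close>.\<close>
      then have "(J has_real_derivative x * y * (bin_weight s t (hi l) - bin_weight s t (lo l))) (at l)"
        unfolding e1 e2 by (rule DERIV_cong) (simp add: algebra_simps)
      moreover have "x * y * (bin_weight s t (hi l) - bin_weight s t (lo l)) \<ge> 0"
        using bin_weight_lo_le_hi[OF l(1)] mode_coords by (intro mult_nonneg_nonneg) auto
      ultimately show "\<exists>y. (J has_real_derivative y) (at l) \<and> 0 \<le> y" by blast
    qed
    then show ?thesis by (simp add: J0)
  qed
  have cont: "isCont (weak_tail s t) x" "isCont (strict_tail s t) x"
    using DERIV_isCont[OF DERIV_weak_tail[OF s_gt_1 t]] DERIV_isCont[OF DERIV_strict_tail[OF s_gt_1 t]] mode_coords by auto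
  have "(J \<longlongrightarrow> weak_tail s t x + strict_tail s t x - strict_tail s t 1 - 0) at_top"
    unfolding J_def[abs_def]
    by (intro tendsto_diff tendsto_add tendsto_const gap_tendsto_0
        isCont_tendsto_compose[OF cont(1)] isCont_tendsto_compose[OF cont(2)] path_tendsto)
  then have "weak_tail s t x + strict_tail s t x - strict_tail s t 1 - 0 \<ge> 0"
    using J by (intro tendsto_lowerbound[of J _ at_top])
      (auto intro!: eventually_mono[OF eventually_gt_at_top[of 0]])
  then show ?thesis
    using mode_coords by (intro equipoint_leI[OF s_gt_1 t]) (auto simp: tail_1[OF s_gt_1 t])
qed

end

section \<open>The equipoint is at least the mean\<close>

text \<open>
  Dividing out a root between \<open>0\<close> and \<open>q\<close> leaves a linear factor that is negative at both ends,
  hence in between.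
\<close>
lemma quadratic_sign_change:
  fixes p :: "real \<Rightarrow> real"
  assumes p: "\<And>z. p z = a + b * z + c * z\<^sup>2"
    and q: "q > 0" and p0: "p 0 > 0" and pq: "p q < 0"
  obtains r where "0 < r" "r < q" "\<And>z. 0 \<le> z \<Longrightarrow> z < r \<Longrightarrow> p z > 0" "\<And>z. r < z \<Longrightarrow> z \<le> q \<Longrightarrow> p z < 0"
proof -
  have "continuous_on {0..q} p" unfolding p by (intro continuous_intros)
  then obtain r where r: "0 \<le> r" "r \<le> q" "p r = 0"
    using IVT2'[of p q 0 0] p0 pq q by auto
  then have r': "0 < r" "r < q" using p0 pq by (metis less_eq_real_def less_irrefl)+
  have fac: "p z = (z - r) * (b + c * (z + r))" for z
  proof -
    have "p z = p z - p r" using r by simp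
    also have "\<dots> = (z - r) * (b + c * (z + r))"
      by (simp add: p power2_eq_square algebra_simps)
    finally show ?thesis .
  qed
  have 0: "b + c * (0 + r) < 0" using p0 r' unfolding fac by (auto simp: zero_less_mult_iff mult_less_0_iff)
  have 1: "b + c * (q + r) < 0" using pq r' unfolding fac by (auto simp: mult_less_0_iff)
  have neg: "b + c * (z + r) < 0" if "0 \<le> z" "z \<le> q" for z
  proof (cases "c \<ge> 0")
    case True
    then have "c * z \<le> c * q" using that by (intro mult_left_mono)
    then show ?thesis using 1 by (simp add: algebra_simps)
  next
    case False
    then have "c * z \<le> 0" using that by (simp add: mult_nonpos_nonneg)
    then show ?thesis using 0 by (simp add: algebra_simps)
  qed
  show thesis
  proof (rule that[OF r'])
    show "p z > 0" if "0 \<le> z" "z < r" for z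
      unfolding fac using that r neg[of z] by (intro mult_neg_neg) auto
    show "p z < 0" if "r < z" "z \<le> q" for z
      unfolding fac using that r neg[of z] by (intro mult_pos_neg) auto
  qed
qed

text \<open>
  The function stays nonnegative while it increases from \<open>0\<close>, so only its decreasing part can
  change sign, and only once; \<open>z0\<close> is the place, or \<open>n\<close> if there is none.
\<close>
lemma single_crossing:
  fixes R R' :: "real \<Rightarrow> real"
  assumes r: "0 < r" "r < n"
    and R0: "R 0 = 0"
    and D: "\<And>z. 0 \<le> z \<Longrightarrow> z < n \<Longrightarrow> (R has_real_derivative R' z) (at z)"
    and up: "\<And>z. 0 \<le> z \<Longrightarrow> z < r \<Longrightarrow> R' z \<ge> 0"
    and down: "\<And>z. r < z \<Longrightarrow> z < n \<Longrightarrow> R' z \<le> 0"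
  obtains z0 where "0 < z0" "z0 \<le> n" "\<And>z. 0 \<le> z \<Longrightarrow> z < n \<Longrightarrow> (z0 - z) * R z \<ge> 0"
proof -
  have cont: "continuous_on {a..b} R" if "0 \<le> a" "b < n" for a b
    by (rule DERIV_continuous_on[of _ _ R'], rule has_field_derivative_at_within, rule D) (use that in auto)
  have mono: "R a \<le> R b" if "0 \<le> a" "a \<le> b" "b \<le> r" for a b
  proof (rule DERIV_nonneg_imp_increasing_open[OF \<open>a \<le> b\<close>])
    show "\<exists>y. (R has_real_derivative y) (at z) \<and> 0 \<le> y" if "a < z" "z < b" for z
      using D[of z] up[of z] that \<open>0 \<le> a\<close> \<open>b \<le> r\<close> r by auto
  qed (use that r in \<open>auto intro: cont\<close>)
  have anti: "R b \<le> R a" if "r \<le> a" "a \<le> b" "b < n" for a b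
  proof (rule DERIV_nonpos_imp_decreasing_open[OF \<open>a \<le> b\<close>])
    show "\<exists>y. (R has_real_derivative y) (at z) \<and> y \<le> 0" if "a < z" "z < b" for z
      using D[of z] down[of z] that \<open>r \<le> a\<close> \<open>b < n\<close> r by auto
  qed (use that r in \<open>auto intro: cont\<close>)
  show thesis
  proof (cases "\<exists>z1. 0 < z1 \<and> z1 < n \<and> R z1 < 0")
    case False
    then have "R z \<ge> 0" if "0 \<le> z" "z < n" for z
      using that R0 by (metis less_eq_real_def linorder_not_le)
    then show thesis using r by (intro that[of n]) auto
  next
    case True
    then obtain z1 where z1: "0 < z1" "z1 < n" "R z1 < 0" by blast
    have "z1 > r" using mono[of 0 z1] z1 R0 by force
    moreover have "R r \<ge> 0" using mono[of 0 r] R0 r by simp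
    ultimately obtain z0 where z0: "r \<le> z0" "z0 \<le> z1" "R z0 = 0"
      using IVT2'[of R z1 0 r] z1 r cont[of r z1] by auto
    have "(z0 - z) * R z \<ge> 0" if z: "0 \<le> z" "z < n" for z
    proof (cases "z \<le> z0")
      case True
      have "R z \<ge> 0"
        using mono[of 0 z] anti[of z z0] z z0 z1 R0 True by (cases "z \<le> r") auto
      with True show ?thesis by simp
    next
      case False
      then have "R z \<le> 0" using anti[of z0 z] z z0 by auto
      with False show ?thesis by (simp add: mult_nonpos_nonpos)
    qed
    then show thesis using z0 z1 r by (intro that[of z0]) auto
  qed
qed

context
  fixes s t m n :: real
  assumes t: "t > 1" and ts: "t < s"
  defines "m \<equiv> (s + 1 / 2) / (s + t + 1)" and "n \<equiv> (t + 1 / 2) / (s + t + 1)"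
begin

text \<open>
  The density whose integral is \<open>weak_tail + strict_tail\<close>; up to normalisation it has median
  \<open>equipoint s t\<close> and mean \<open>m\<close>.
\<close>
private definition g where "g u = (s * (1 - u) + t * u) * bin_kernel s t u"

private lemma mean_coords: "0 < n" "n < m" "m < 1" "m + n = 1"
  using t ts unfolding m_def n_def by (simp_all add: divide_simps)

text \<open>
  The function \<open>R z = ln (g (m + z)) - ln (g (m - z))\<close> vanishes at \<open>0\<close>, and its derivative is a
  positive function times a quadratic \<open>N\<close> in \<open>z\<^sup>2\<close>. The end values \<open>N 0 > 0\<close> and \<open>N (n\<^sup>2) < 0\<close>,
  the latter due to \<open>t > 1\<close>, leave a single sign change for \<open>N\<close>, so that \<open>g\<close> is at first larger
  on the right of \<open>m\<close> and then possibly on the left.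
\<close>
private lemma mean_crossing:
  obtains z0 where "0 < z0" "z0 \<le> n" "\<And>z. 0 \<le> z \<Longrightarrow> z < n \<Longrightarrow> (z0 - z) * (g (m + z) - g (m - z)) \<ge> 0"
proof -
  define B where "B = s - t"
  define K where "K = s * n + t * m"
  \<comment> \<open>\<open>K - B z\<close> is the linear factor of \<open>g\<close> at \<open>m + z\<close>.\<close>
  define R where "R z = (s - 1) * (ln (m + z) - ln (m - z)) + (t - 1) * (ln (n - z) - ln (n + z))
      + (ln (K - B * z) - ln (K + B * z))" for z
  define R' where "R' z = (s - 1) * (1 / (m + z) + 1 / (m - z)) - (t - 1) * (1 / (n - z) + 1 / (n + z))
      - B * (1 / (K - B * z) + 1 / (K + B * z))" for z
  define N where "N Z = (s - 1) * m * (n\<^sup>2 - Z) * (K\<^sup>2 - B\<^sup>2 * Z)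
      - (t - 1) * n * (m\<^sup>2 - Z) * (K\<^sup>2 - B\<^sup>2 * Z) - B * K * (m\<^sup>2 - Z) * (n\<^sup>2 - Z)" for Z
  have B: "B > 0" using ts by (simp add: B_def)
  have KB: "K > B * n"
  proof -
    have "K - B * n = t * (m + n)" by (simp add: K_def B_def algebra_simps)
    then show ?thesis using mean_coords t by simp
  qed
  have K: "K > 0" using KB B mean_coords by (smt (verit) mult_pos_pos)
  have pos: "m - z > 0" "m + z > 0" "n - z > 0" "n + z > 0" "K - B * z > 0" "K + B * z > 0"
    if "0 \<le> z" "z < n" for z
  proof -
    have "B * z < B * n" "B * z \<ge> 0" using that B by auto
    then show "m - z > 0" "m + z > 0" "n - z > 0" "n + z > 0" "K - B * z > 0" "K + B * z > 0"
      using that mean_coords KB K by auto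
  qed
  have DR: "(R has_real_derivative R' z) (at z)" if "0 \<le> z" "z < n" for z
  proof -
    have D: "((\<lambda>z. ln (a + c * z) - ln (a - c * z)) has_real_derivative c * (1 / (a + c * z) + 1 / (a - c * z))) (at z)"
      if "a + c * z > 0" "a - c * z > 0" for a c
      using that by (auto intro!: derivative_eq_intros simp: distrib_left)
    note p = pos[OF that]
    have "((\<lambda>z. ln (m + z) - ln (m - z)) has_real_derivative 1 / (m + z) + 1 / (m - z)) (at z)"
      "((\<lambda>z. ln (n - z) - ln (n + z)) has_real_derivative - (1 / (n - z) + 1 / (n + z))) (at z)"
      "((\<lambda>z. ln (K - B * z) - ln (K + B * z)) has_real_derivative
          - (B * (1 / (K - B * z) + 1 / (K + B * z)))) (at z)"
      using p D[of m 1] D[of n "-1"] D[of K "- B"] by simp_all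
    from DERIV_add[OF DERIV_add[OF DERIV_cmult[OF this(1)] DERIV_cmult[OF this(2)]] this(3)]
    show ?thesis unfolding R_def[abs_def] R'_def by (rule DERIV_cong) (simp add: right_diff_distrib distrib_left)
  qed
  have R'N: "R' z = 2 * N (z\<^sup>2) / ((m\<^sup>2 - z\<^sup>2) * (n\<^sup>2 - z\<^sup>2) * (K\<^sup>2 - (B * z)\<^sup>2))"
    and den: "(m\<^sup>2 - z\<^sup>2) * (n\<^sup>2 - z\<^sup>2) * (K\<^sup>2 - (B * z)\<^sup>2) > 0" if "0 \<le> z" "z < n" for z
  proof -
    note p = pos[OF that]
    have sq: "m\<^sup>2 - z\<^sup>2 = (m + z) * (m - z)" "n\<^sup>2 - z\<^sup>2 = (n + z) * (n - z)"
      "K\<^sup>2 - (B * z)\<^sup>2 = (K + B * z) * (K - B * z)"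
      by (simp_all add: power2_eq_square algebra_simps)
    show den: "(m\<^sup>2 - z\<^sup>2) * (n\<^sup>2 - z\<^sup>2) * (K\<^sup>2 - (B * z)\<^sup>2) > 0"
      unfolding sq using p by (intro mult_pos_pos)
    have pf: "1 / (a + c) + 1 / (a - c) = 2 * a / (a\<^sup>2 - c\<^sup>2)" if "a + c > 0" "a - c > 0" for a c :: real
      using that by (simp add: power2_eq_square square_diff_square_factored add_frac_eq)
    have cd: "a * (2 * p / X) - b * (2 * q / Y) - e * (2 * f / W)
        = 2 * (a * p * Y * W - b * q * X * W - e * f * X * Y) / (X * Y * W)"
      if "X * Y * W > 0" for a b e f p q X Y W :: real
    proof -
      have "X \<noteq> 0" "Y \<noteq> 0" "W \<noteq> 0" using that by auto
      then show ?thesis by (simp add: field_simps)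
    qed
    have "R' z = (s - 1) * (2 * m / (m\<^sup>2 - z\<^sup>2)) - (t - 1) * (2 * n / (n\<^sup>2 - z\<^sup>2))
        - B * (2 * K / (K\<^sup>2 - (B * z)\<^sup>2))"
      unfolding R'_def using p by (simp only: pf[symmetric]) (simp add: add.commute)
    also have "\<dots> = 2 * N (z\<^sup>2) / ((m\<^sup>2 - z\<^sup>2) * (n\<^sup>2 - z\<^sup>2) * (K\<^sup>2 - (B * z)\<^sup>2))"
      using cd[OF den] by (simp only: N_def power_mult_distrib)
    finally show "R' z = 2 * N (z\<^sup>2) / ((m\<^sup>2 - z\<^sup>2) * (n\<^sup>2 - z\<^sup>2) * (K\<^sup>2 - (B * z)\<^sup>2))" .
  qed
  have Nq: "N Z = N 0 + (- (s - 1) * m * (K\<^sup>2 + B\<^sup>2 * n\<^sup>2) + (t - 1) * n * (K\<^sup>2 + B\<^sup>2 * m\<^sup>2) + B * K * (m\<^sup>2 + n\<^sup>2)) * Z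
      + ((s - 1) * m * B\<^sup>2 - (t - 1) * n * B\<^sup>2 - B * K) * Z\<^sup>2" for Z
    by (simp add: N_def power2_eq_square algebra_simps)
  have N0: "N 0 > 0"
  proof -
    have d: "s + t + 1 > 0" using t ts by simp
    have "(s - 1) * n - (t - 1) * m = 3 / 2 * B / (s + t + 1)"
      using d by (simp add: n_def m_def B_def divide_simps) (simp add: algebra_simps)
    moreover have "N 0 = m * n * K * (((s - 1) * n - (t - 1) * m) * K - B * (m * n))"
      by (simp add: N_def power2_eq_square algebra_simps)
    ultimately have "N 0 = m * n * K * B * (3 / 2 * K / (s + t + 1) - m * n)"
      by (simp add: algebra_simps)
    moreover have "3 / 2 * K / (s + t + 1) - m * n = (2 * s * t + (s + t - 1) / 4) / (s + t + 1)\<^sup>2"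
      using d by (simp add: n_def m_def K_def divide_simps) (simp add: power2_eq_square algebra_simps)
    moreover have "(2 * s * t + (s + t - 1) / 4) / (s + t + 1)\<^sup>2 > 0"
      using t ts by (intro divide_pos_pos add_pos_pos mult_pos_pos) auto
    ultimately show ?thesis using mean_coords K B by (simp only:) (intro mult_pos_pos, auto)
  qed
  have Nn: "N (n\<^sup>2) < 0"
  proof -
    have "N (n\<^sup>2) = - ((t - 1) * n * ((m + n) * (m - n)) * ((K + B * n) * (K - B * n)))"
      by (simp add: N_def power2_eq_square algebra_simps)
    also have "\<dots> < 0"
      using t mean_coords KB K B by (simp only: neg_less_0_iff_less) (intro mult_pos_pos add_pos_pos, auto)
    finally show ?thesis .
  qed
  obtain Z where Z: "0 < Z" "Z < n\<^sup>2" "\<And>z. 0 \<le> z \<Longrightarrow> z < Z \<Longrightarrow> N z > 0" "\<And>z. Z < z \<Longrightarrow> z \<le> n\<^sup>2 \<Longrightarrow> N z < 0"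
    using quadratic_sign_change[OF Nq _ N0 Nn] mean_coords by auto
  obtain z0 where z0: "0 < z0" "z0 \<le> n" "\<And>z. 0 \<le> z \<Longrightarrow> z < n \<Longrightarrow> (z0 - z) * R z \<ge> 0"
  proof (rule single_crossing[of "sqrt Z" n R R'])
    show "0 < sqrt Z" using Z by simp
    show sn: "sqrt Z < n" using Z mean_coords by (simp add: real_less_lsqrt)
    show "R 0 = 0" by (simp add: R_def)
    show "R' z \<ge> 0" if "0 \<le> z" "z < sqrt Z" for z
    proof -
      have "z\<^sup>2 < Z" using that Z by (metis real_sqrt_less_iff real_sqrt_unique)
      then show ?thesis using Z(3)[of "z\<^sup>2"] that R'N[of z] den[of z] sn by simp
    qed
    show "R' z \<le> 0" if "sqrt Z < z" "z < n" for z
    proof -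
      have z: "0 \<le> z" using that Z by (smt (verit) real_sqrt_ge_zero)
      have "Z < z\<^sup>2" using that Z z by (metis real_sqrt_less_iff real_sqrt_unique)
      moreover have "z\<^sup>2 \<le> n\<^sup>2" using that z by simp
      ultimately show ?thesis
        using Z(4)[of "z\<^sup>2"] z that R'N[of z] den[of z] by (simp add: divide_nonpos_pos)
    qed
  qed (use DR in auto)
  have lng: "ln (g u) = (s - 1) * ln u + (t - 1) * ln (1 - u) + ln (s * (1 - u) + t * u)"
    and gpos: "g u > 0" if "0 < u" "u < 1" for u
  proof -
    have l: "s * (1 - u) + t * u > 0" using that t ts by (intro add_pos_pos mult_pos_pos) auto
    then show "g u > 0" using that by (simp add: g_def bin_kernel_pos)
    show "ln (g u) = (s - 1) * ln u + (t - 1) * ln (1 - u) + ln (s * (1 - u) + t * u)"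
      using l that by (simp add: g_def bin_kernel_def ln_mult ln_powr)
  qed
  show thesis
  proof (rule that[OF z0(1,2)])
    fix z assume z: "0 \<le> z" "z < n"
    have u: "0 < m + z" "m + z < 1" "0 < m - z" "m - z < 1" using z mean_coords by auto
    have e: "1 - (m + z) = n - z" "1 - (m - z) = n + z" using mean_coords by auto
    have "ln (g (m + z)) - ln (g (m - z)) = R z"
      using u by (simp only: lng e R_def K_def B_def) (simp add: algebra_simps)
    moreover have "g (m + z) > 0" "g (m - z) > 0" using u by (auto intro: gpos)
    ultimately have "R z > 0 \<Longrightarrow> g (m + z) > g (m - z)" "R z < 0 \<Longrightarrow> g (m + z) < g (m - z)"
      "R z = 0 \<Longrightarrow> g (m + z) = g (m - z)"
      using ln_less_cancel_iff ln_inj_iff by (smt (verit))+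
    then show "(z0 - z) * (g (m + z) - g (m - z)) \<ge> 0"
      using z0(3)[OF z] by (cases "R z" "0 :: real" rule: linorder_cases) (auto simp: zero_le_mult_iff)
  qed
qed

text \<open>
  The mean is at most the median of a density with the crossing property above: the first moment
  of \<open>g (m + z) - g (m - z)\<close> vanishes, and subtracting \<open>1 / z0\<close> times it from the integral of
  this difference leaves the integrand \<open>(1 - z / z0) (g (m + z) - g (m - z)) \<ge> 0\<close>. Here \<open>g\<close>
  counts as \<open>0\<close> outside the unit interval, which is the reason for treating one part separately:
  the points to the left of \<open>m - n\<close> have no mirror image in the unit interval; there the factor
  \<open>1 - z / z0\<close> is nonpositive, since \<open>z \<ge> n \<ge> z0\<close>.
\<close>
lemma mean_le_equipoint: "m \<le> equipoint s t"
proof -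
  have s: "s > 1" using t ts by simp
  define G where "G u = weak_tail s t u + strict_tail s t u" for u
  \<comment> \<open>\<open>E\<close> is an antiderivative of \<open>(u - m) g(u)\<close>; that it vanishes at both ends of the unit
    interval says that \<open>m\<close> is the mean.\<close>
  define E where "E u = ((s - t) / (s + t + 1) * u - m) * bin_weight s t u" for u
  have DG: "(G has_real_derivative g u) (at u)" if "0 < u" "u < 1" for u
    unfolding G_def g_def
    by (rule DERIV_cong[OF DERIV_add[OF DERIV_weak_tail[OF s t that] DERIV_strict_tail[OF s t that]]])
      (simp add: algebra_simps)
  have DE: "(E has_real_derivative (u - m) * g u) (at u)" if u: "0 < u" "u < 1" for u
  proof -
    define c where "c = (s - t) / (s + t + 1)"
    have c: "c * (s + t + 1) = s - t" and m': "m * (s + t + 1) = s + 1 / 2"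
      using t ts by (simp_all add: c_def m_def)
    have "((\<lambda>u. (c * u - m) * bin_weight s t u) has_real_derivative
        c * bin_weight s t u + (c * u - m) * ((s - (s + t) * u) * bin_kernel s t u)) (at u)"
      by (rule DERIV_cong[OF DERIV_mult[OF _ DERIV_bin_weight[OF u]]])
        (auto intro!: derivative_eq_intros simp: algebra_simps)
    moreover have "c * bin_weight s t u + (c * u - m) * ((s - (s + t) * u) * bin_kernel s t u)
       = (c * (u * (1 - u)) + (c * u - m) * (s - (s + t) * u)) * bin_kernel s t u"
      using u by (simp add: bin_kernel_mult algebra_simps)
    moreover have "c * (u * (1 - u)) + (c * u - m) * (s - (s + t) * u)
       = (u - m) * (s * (1 - u) + t * u)"
    proof -
      have "(s + t + 1) * (c * (u * (1 - u)) + (c * u - m) * (s - (s + t) * u))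
         = (c * (s + t + 1)) * (u * (1 - u)) + ((c * (s + t + 1)) * u - m * (s + t + 1)) * (s - (s + t) * u)"
        by (simp add: algebra_simps)
      also have "\<dots> = ((s + t + 1) * u - m * (s + t + 1)) * (s * (1 - u) + t * u)"
        unfolding c m' by (simp add: algebra_simps)
      also have "\<dots> = (s + t + 1) * ((u - m) * (s * (1 - u) + t * u))"
        by (simp add: algebra_simps)
      finally show ?thesis using s t by simp
    qed
    ultimately show ?thesis
      unfolding E_def g_def c_def[symmetric] by (simp add: mult.assoc)
  qed
  have contG: "continuous_on {0..1} G" and contE: "continuous_on {0..1} E"
    unfolding G_def E_def using s t
    by (auto intro!: continuous_intros continuous_on_weak_tail continuous_on_strict_tail
        continuous_on_bin_weight_Icc)
  have G0: "G 0 = 0" and E0: "E 0 = 0" and E1: "E 1 = 0" and G1: "G 1 = 2 / bin_coeff s t"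
    using s t by (simp_all add: G_def E_def bin_weight_def tail_1)
  have g_nonneg: "g u \<ge> 0" if "0 < u" "u < 1" for u
    unfolding g_def using that s t bin_kernel_pos[OF that] by (intro mult_nonneg_nonneg add_nonneg_nonneg less_imp_le[OF bin_kernel_pos]) auto
  obtain z0 where z0: "0 < z0" "z0 \<le> n" "\<And>z. 0 \<le> z \<Longrightarrow> z < n \<Longrightarrow> (z0 - z) * (g (m + z) - g (m - z)) \<ge> 0"
    using mean_crossing by blast
  have 1: "z0 * (G (m + 0) - 2 * G m + G (m - 0)) - (E (m + 0) - E (m - 0))
     \<le> z0 * (G (m + n) - 2 * G m + G (m - n)) - (E (m + n) - E (m - n))"
  proof (rule DERIV_nonneg_imp_increasing_open[of 0 n])
    fix z assume z: "0 < z" "z < n"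
    have u: "0 < m + z" "m + z < 1" "0 < m - z" "m - z < 1" using z mean_coords by auto
    have a: "((\<lambda>z. m + z) has_real_derivative 1) (at z)" and b: "((\<lambda>z. m - z) has_real_derivative - 1) (at z)"
      by (auto intro!: derivative_eq_intros)
    have D: "((\<lambda>z. G (m + z)) has_real_derivative g (m + z) * 1) (at z)"
      "((\<lambda>z. G (m - z)) has_real_derivative g (m - z) * - 1) (at z)"
      "((\<lambda>z. E (m + z)) has_real_derivative (m + z - m) * g (m + z) * 1) (at z)"
      "((\<lambda>z. E (m - z)) has_real_derivative (m - z - m) * g (m - z) * - 1) (at z)"
      by (rule DERIV_chain2[OF DG[OF u(1,2)] a] DERIV_chain2[OF DG[OF u(3,4)] b]
            DERIV_chain2[OF DE[OF u(1,2)] a] DERIV_chain2[OF DE[OF u(3,4)] b])+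
    have "((\<lambda>z. z0 * (G (m + z) - 2 * G m + G (m - z)) - (E (m + z) - E (m - z))) has_real_derivative
        (z0 - z) * (g (m + z) - g (m - z))) (at z)"
      by (rule DERIV_cong[OF DERIV_diff[OF DERIV_cmult[OF DERIV_add[OF DERIV_diff[OF D(1) DERIV_const] D(2)]]
          DERIV_diff[OF D(3,4)]]]) (simp add: algebra_simps)
    then show "\<exists>y. ((\<lambda>z. z0 * (G (m + z) - 2 * G m + G (m - z)) - (E (m + z) - E (m - z)))
        has_real_derivative y) (at z) \<and> 0 \<le> y"
      using z0(3)[of z] z by auto
  next
    show "continuous_on {0..n} (\<lambda>z. z0 * (G (m + z) - 2 * G m + G (m - z)) - (E (m + z) - E (m - z)))"
      using mean_coords by (intro continuous_intros continuous_on_compose2[OF contG] continuous_on_compose2[OF contE]) auto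
  qed (use mean_coords in simp)
  \<comment> \<open>On the unmatched part \<open>m - u \<ge> n\<close>, so its first moment is at least \<open>n\<close> times its mass.\<close>
  have 2: "E (m - n) + n * G (m - n) \<le> E 0 + n * G 0"
  proof (rule DERIV_nonpos_imp_decreasing_open[of 0 "m - n"])
    fix u assume u: "0 < u" "u < m - n"
    then have u1: "u < 1" using mean_coords by auto
    have "((\<lambda>u. E u + n * G u) has_real_derivative (u - (m - n)) * g u) (at u)"
      by (rule DERIV_cong[OF DERIV_add[OF DE[OF u(1) u1] DERIV_cmult[OF DG[OF u(1) u1]]]])
        (simp add: algebra_simps)
    moreover have "(u - (m - n)) * g u \<le> 0"
      using g_nonneg[OF u(1) u1] u by (intro mult_nonpos_nonneg) auto
    ultimately show "\<exists>y. ((\<lambda>u. E u + n * G u) has_real_derivative y) (at u) \<and> y \<le> 0" by blast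
  next
    show "continuous_on {0..m - n} (\<lambda>u. E u + n * G u)"
      using mean_coords by (intro continuous_intros continuous_on_subset[OF contG] continuous_on_subset[OF contE]) auto
  qed (use mean_coords in simp)
  have 3: "G 0 \<le> G (m - n)"
  proof (rule DERIV_nonneg_imp_increasing_open[of 0 "m - n"])
    show "continuous_on {0..m - n} G" using mean_coords by (intro continuous_on_subset[OF contG]) auto
    show "\<exists>y. (G has_real_derivative y) (at u) \<and> 0 \<le> y" if "0 < u" "u < m - n" for u
      using DG[of u] g_nonneg[of u] that mean_coords by auto
  qed (use mean_coords in simp)
  have "z0 * (G 1 - 2 * G m + G (m - n)) \<ge> n * G (m - n)"
    using 1 2 by (simp add: mean_coords E0 E1 G0)
  moreover have "n * G (m - n) \<ge> z0 * G (m - n)" using 3 z0 by (intro mult_right_mono) (auto simp: G0)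
  ultimately have "z0 * (G 1 - 2 * G m) \<ge> 0" by (simp add: algebra_simps)
  then have "2 * G m \<le> G 1" using z0 by (simp add: zero_le_mult_iff)
  then show ?thesis
    unfolding G1 using mean_coords by (intro equipoint_geI[OF s t]) (auto simp: G_def)
qed

end

section \<open>Growth of the mass at the mean\<close>

text \<open>
  Each term of the series \<open>\<Sum>k. 1 / (z + 1/2 + k)\<^sup>2\<close> is at most the matching term of a
  telescoping series with sum \<open>1 / z\<close>, by \<open>(z + k) (z + k + 1) \<le> (z + k + 1/2)\<^sup>2\<close>.
\<close>
lemma Polygamma_1_half_shift_le:
  assumes z: "z > (0::real)"
  shows "Polygamma 1 (z + 1 / 2) \<le> 1 / z"
proof -
  have "(\<lambda>k. inverse ((z + 1 / 2 + of_nat k)\<^sup>2)) sums Polygamma 1 (z + 1 / 2)"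
    using Polygamma_LIMSEQ[of "z + 1 / 2" 1] z by (simp add: numeral_2_eq_2)
  moreover have "(\<lambda>k. 1 / (z + real k)) \<longlonglongrightarrow> 0"
    by real_asymp
  from telescope_sums'[OF this]
  have "(\<lambda>k. 1 / (z + real k) - 1 / (z + real (Suc k))) sums (1 / z)" by simp
  moreover have "inverse ((z + 1 / 2 + of_nat k)\<^sup>2) \<le> 1 / (z + real k) - 1 / (z + real (Suc k))" for k
  proof -
    have p: "z + real k > 0" using z by simp
    have "1 / (z + real k) - 1 / (z + real (Suc k)) = 1 / ((z + real k) * (z + real k + 1))"
      using p by (simp add: field_simps)
    moreover have "(z + real k) * (z + real k + 1) \<le> (z + 1 / 2 + real k)\<^sup>2"
      by (simp add: power2_eq_square algebra_simps)
    ultimately show ?thesis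
      using p by (simp add: inverse_eq_divide frac_le)
  qed
  ultimately show ?thesis by (rule sums_le[rotated])
qed

text \<open>
  The logarithm of the mass at the mean, up to a term that depends on \<open>s + t\<close> only (see
  \<open>ln_bin_mass_mean\<close>).
\<close>
definition mean_log where
  "mean_log s t = s * ln (s + 1 / 2) + t * ln (t + 1 / 2) - ln_Gamma (s + 1) - ln_Gamma (t + 1 :: real)"

text \<open>
  The difference \<open>h s - h t\<close> is the derivative of \<open>mean_log s (d - s)\<close> in \<open>s\<close>, for \<open>t = d - s\<close>.
  The trigamma bound gives \<open>h' u \<ge> 1 / (2 (u + 1/2)\<^sup>2)\<close>, so adding the antiderivative
  \<open>1 / (2 (u + 1/2))\<close> of the negative of the right side keeps the function increasing.
\<close>
lemma mean_log_slope:
  assumes "0 < t" "t \<le> (s::real)"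
  defines "h \<equiv> \<lambda>s. ln (s + 1 / 2) + s / (s + 1 / 2) - Digamma (s + 1)"
  shows "2 * (s - t) / (s + t + 1)\<^sup>2 \<le> h s - h t"
proof -
  let ?g = "\<lambda>u. h u + 1 / (u + 1 / 2) / 2"
  have "?g t \<le> ?g s"
  proof (rule DERIV_nonneg_imp_nondecreasing[OF assms(2)])
    fix u assume u: "t \<le> u" "u \<le> s"
    then have u0: "u > 0" using assms by simp
    have D: "((\<lambda>u. ln (u + 1 / 2)) has_real_derivative 1 / (u + 1 / 2)) (at u)"
      "((\<lambda>u. u / (u + 1 / 2)) has_real_derivative ((u + 1 / 2) - u) / (u + 1 / 2)\<^sup>2) (at u)"
      "((\<lambda>u. Digamma (u + 1)) has_real_derivative Polygamma 1 (u + 1)) (at u)"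
      using u0 by (auto intro!: derivative_eq_intros dest: nonpos_Ints_nonpos
          simp: power2_eq_square)
    have D4: "((\<lambda>u. 1 / (u + 1 / 2) / 2) has_real_derivative - (1 / (u + 1 / 2)\<^sup>2) / 2) (at u)"
      by (rule DERIV_cong[OF DERIV_cdivide[OF DERIV_divide[OF DERIV_const DERIV_add[OF DERIV_ident DERIV_const]]]])
        (use u0 in \<open>auto simp: power2_eq_square\<close>)
    have "(?g has_real_derivative
       1 / (u + 1 / 2) + ((u + 1 / 2) - u) / (u + 1 / 2)\<^sup>2 - Polygamma 1 (u + 1)
        + - (1 / (u + 1 / 2)\<^sup>2) / 2) (at u)"
      unfolding h_def by (intro DERIV_add DERIV_diff D D4)
    moreover have "Polygamma 1 (u + 1) \<le> 1 / (u + 1 / 2)"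
      using Polygamma_1_half_shift_le[of "u + 1 / 2"] u0 by (simp add: add.assoc)
    moreover have "((u + 1 / 2) - u) / (u + 1 / 2)\<^sup>2 = 1 / (u + 1 / 2)\<^sup>2 / 2"
      by simp
    ultimately show "\<exists>y. (?g has_real_derivative y) (at u) \<and> 0 \<le> y" by fastforce
  qed
  moreover have "1 / (t + 1 / 2) / 2 - 1 / (s + 1 / 2) / 2 \<ge> 2 * (s - t) / (s + t + 1)\<^sup>2"
  proof -
    have eq: "1 / (t + 1 / 2) / 2 - 1 / (s + 1 / 2) / 2 = 2 * (s - t) / (4 * ((t + 1 / 2) * (s + 1 / 2)))"
      using assms by (simp add: divide_simps) (simp add: algebra_simps)
    have "4 * ((t + 1 / 2) * (s + 1 / 2)) \<le> (s + t + 1)\<^sup>2"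
      using zero_le_power2[of "s - t"] by (simp add: power2_eq_square algebra_simps)
    then show ?thesis
      unfolding eq using assms by (intro divide_left_mono mult_pos_pos) auto
  qed
  ultimately show ?thesis by linarith
qed

lemma mean_log_growth:
  assumes "d / 2 \<le> a" "a \<le> b" "b < d"
  shows "mean_log a (d - a) + 2 * ((b - d / 2)\<^sup>2 - (a - d / 2)\<^sup>2) / (d + 1)\<^sup>2 \<le> mean_log b (d - b)"
proof -
  let ?h = "\<lambda>s. ln (s + 1 / 2) + s / (s + 1 / 2) - Digamma (s + 1 :: real)"
  let ?f = "\<lambda>s. mean_log s (d - s) - 2 * (s - d / 2)\<^sup>2 / (d + 1)\<^sup>2"
  have "?f a \<le> ?f b"
  proof (rule DERIV_nonneg_imp_nondecreasing[OF assms(2)])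
    fix u assume u: "a \<le> u" "u \<le> b"
    have u0: "u > 0" "d - u > 0" "d > 0" using assms u by auto
    have D: "((\<lambda>s. ln_Gamma (s + 1)) has_real_derivative Digamma (u + 1)) (at u)"
      "((\<lambda>s. ln_Gamma (d - s + 1)) has_real_derivative - Digamma (d - u + 1)) (at u)"
      "((\<lambda>s. s * ln (s + 1 / 2)) has_real_derivative ln (u + 1 / 2) + u / (u + 1 / 2)) (at u)"
      "((\<lambda>s. (d - s) * ln (d - s + 1 / 2)) has_real_derivative
          - (ln (d - u + 1 / 2) + (d - u) / (d - u + 1 / 2))) (at u)"
      using u0 by (auto intro!: derivative_eq_intros simp: divide_simps)
    have D5: "((\<lambda>s. 2 * (s - d / 2)\<^sup>2 / (d + 1)\<^sup>2) has_real_derivative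
        2 * (2 * (u - d / 2)) / (d + 1)\<^sup>2) (at u)"
      by (rule DERIV_cong[OF DERIV_cdivide[OF DERIV_cmult[OF DERIV_power[OF
              DERIV_diff[OF DERIV_ident DERIV_const]]]]]) simp
    have "(?f has_real_derivative ?h u - ?h (d - u) - 2 * (2 * (u - d / 2)) / (d + 1)\<^sup>2) (at u)"
      unfolding mean_log_def
      by (rule DERIV_cong[OF DERIV_diff[OF DERIV_diff[OF DERIV_diff[OF DERIV_add[OF
              D(3,4)] D(1)] D(2)] D5]]) simp
    moreover have "0 \<le> ?h u - ?h (d - u) - 2 * (2 * (u - d / 2)) / (d + 1)\<^sup>2"
      using mean_log_slope[of "d - u" u] u0 assms u by (simp add: algebra_simps)
    ultimately show "\<exists>y. (?f has_real_derivative y) (at u) \<and> 0 \<le> y" by blast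
  qed
  then show ?thesis by (simp add: diff_divide_distrib right_diff_distrib)
qed

text \<open>
  The logarithm of the mass at the mode, up to the same term as for \<open>mean_log\<close>. The summand
  \<open>(s + t) ln (s + t + 1)\<close> makes the two omitted terms agree.
\<close>
definition mode_log where
  "mode_log s t = s * ln s + t * ln t - (s + t) * ln (s + t) + (s + t) * ln (s + t + 1) 
     - ln_Gamma (s + 1) - ln_Gamma (t + 1 :: real)"

text \<open>
  The difference is \<open>s + t\<close> times the relative entropy of two distributions on two points, with
  weights given by the mode and by the mean. Relative entropy is at most the chi-square
  divergence, by \<open>ln p \<le> p - 1\<close>.
\<close>
lemma mode_log_le_mean_log:
  assumes "s > 0" "t > 0"
  shows "mode_log s t \<le> mean_log s t + ((s - t) / 2)\<^sup>2 / ((s + t) * (s + 1 / 2) * (t + 1 / 2))"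
proof -
  have A: "ln s - ln (s + t) + ln (s + t + 1) - ln (s + 1 / 2) \<le> s * (s + t + 1) / ((s + t) * (s + 1 / 2)) - 1"
    (is "?a \<le> ?p - 1") if "s > 0" "t > 0" for s t :: real
  proof -
    have "?a = ln ?p" using that by (simp add: ln_mult ln_div)
    also have "\<dots> \<le> ?p - 1" using that by (intro ln_le_minus_one) simp
    finally show ?thesis .
  qed
  have "mode_log s t - mean_log s t = s * (ln s - ln (s + t) + ln (s + t + 1) - ln (s + 1 / 2))
      + t * (ln t - ln (s + t) + ln (s + t + 1) - ln (t + 1 / 2))"
    by (simp add: mode_log_def mean_log_def algebra_simps)
  also have "\<dots> \<le> s * (s * (s + t + 1) / ((s + t) * (s + 1 / 2)) - 1)
      + t * (t * (s + t + 1) / ((s + t) * (t + 1 / 2)) - 1)"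
    using A[of s t] A[of t s] assms by (intro add_mono mult_left_mono) (simp_all add: add_ac)
  also have "\<dots> = ((s - t) / 2)\<^sup>2 / ((s + t) * (s + 1 / 2) * (t + 1 / 2))"
    using assms by (simp add: divide_simps) (simp add: power2_eq_square algebra_simps)
  finally show ?thesis by linarith
qed

section \<open>Comparison of the values of \<open>\<Phi>\<close>\<close>

lemma ln_bin_mass:
  assumes "s > 0" "t > 0" "0 < u" "u < 1"
  shows "ln (bin_coeff s t * bin_weight s t u)
    = ln_Gamma (s + t + 1) - ln_Gamma (s + 1) - ln_Gamma (t + 1) + s * ln u + t * ln (1 - u)"
proof -
  have "ln (A / (B * C) * (P * Q)) = ln A - ln B - ln C + ln P + ln Q"
    if "A > 0" "B > 0" "C > 0" "P > 0" "Q > 0" for A B C P Q :: real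
    using that by (simp add: ln_mult ln_div)
  from this[of "Gamma (s + t + 1)" "Gamma (s + 1)" "Gamma (t + 1)" "u powr s" "(1 - u) powr t"]
  show ?thesis
    using assms by (simp add: bin_coeff_def bin_weight_def ln_powr ln_Gamma_real_pos)
qed

lemma ln_bin_mass_mean:
  assumes "s > 0" "t > 0"
  shows "ln (bin_coeff s t * bin_weight s t ((s + 1 / 2) / (s + t + 1)))
    = mean_log s t + ln_Gamma (s + t + 1) - (s + t) * ln (s + t + 1)"
proof -
  have eq: "1 - (s + 1 / 2) / (s + t + 1) = (t + 1 / 2) / (s + t + 1)" using assms by (simp add: field_simps)
  have "(s + 1 / 2) / (s + t + 1) < 1" using assms by simp
  then have "ln (bin_coeff s t * bin_weight s t ((s + 1 / 2) / (s + t + 1)))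
      = ln_Gamma (s + t + 1) - ln_Gamma (s + 1) - ln_Gamma (t + 1)
        + s * ln ((s + 1 / 2) / (s + t + 1)) + t * ln ((t + 1 / 2) / (s + t + 1))"
    unfolding eq[symmetric] using assms by (intro ln_bin_mass) auto
  then show ?thesis
    using assms by (simp add: ln_div mean_log_def algebra_simps)
qed

lemma ln_bin_mass_mode:
  assumes "s > 0" "t > 0"
  shows "ln (bin_coeff s t * bin_weight s t (s / (s + t)))
    = mode_log s t + ln_Gamma (s + t + 1) - (s + t) * ln (s + t + 1)"
proof -
  have eq: "1 - s / (s + t) = t / (s + t)" using assms by (simp add: field_simps)
  have "s / (s + t) < 1" using assms by simp
  then have "ln (bin_coeff s t * bin_weight s t (s / (s + t)))
      = ln_Gamma (s + t + 1) - ln_Gamma (s + 1) - ln_Gamma (t + 1)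
        + s * ln (s / (s + t)) + t * ln (t / (s + t))"
    unfolding eq[symmetric] using assms by (intro ln_bin_mass) auto
  then show ?thesis
    using assms by (simp add: ln_div mode_log_def algebra_simps)
qed

lemma Phi_le_mode:
  assumes "s > 1" "t > 1"
  shows "Phi (s + t) s \<le> (1 + bin_coeff s t * bin_weight s t (s / (s + t))) / 2"
  using bin_weight_le_mode[OF assms equipoint_ge_0[OF assms] equipoint_le_1[OF assms]]
    bin_coeff_pos[of s t] assms
  by (simp add: Phi_eq mult_left_mono)

lemma Phi_ge_mean:
  assumes "t > 1" "t < s"
  shows "Phi (s + t) s \<ge> (1 + bin_coeff s t * bin_weight s t ((s + 1 / 2) / (s + t + 1))) / 2"
proof -
  have s: "s > 1" using assms by simp
  have "bin_weight s t ((s + 1 / 2) / (s + t + 1)) \<le> bin_weight s t (equipoint s t)"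
    using assms by (intro bin_weight_mono s mean_le_equipoint equipoint_le_mode) auto
  then show ?thesis
    using bin_coeff_pos[of s t] assms by (simp add: Phi_eq s mult_left_mono)
qed

text \<open>
  The chain behind this criterion is: mass at the equipoint for \<open>s0\<close>, at most the mass at the mode
  for \<open>s0\<close>, at most the mass at the mean for \<open>s\<close>, at most the mass at the equipoint for \<open>s\<close>.
  The hypothesis \<open>gap\<close> is what the middle step needs: the excess of mode over mean at \<open>s0\<close>
  does not exceed the growth of the mass at the mean from \<open>s0\<close> to \<open>s\<close>.
\<close>
lemma Phi_le_PhiI:
  assumes s0: "d / 2 \<le> s0" "s0 < s" and s: "s < d - 1"
    and gap: "(s0 - d / 2)\<^sup>2 / (d * (s0 + 1 / 2) * (d - s0 + 1 / 2))
      \<le> 2 * ((s - d / 2)\<^sup>2 - (s0 - d / 2)\<^sup>2) / (d + 1)\<^sup>2"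
  shows "Phi d s0 \<le> Phi d s"
proof -
  have pos: "d - s0 > 1" "s0 > 1" "d - s > 1" "d - s < s" "s > 1" using s0 s by auto
  let ?p = "bin_coeff s0 (d - s0) * bin_weight s0 (d - s0) (s0 / d)"
  let ?q = "bin_coeff s (d - s) * bin_weight s (d - s) ((s + 1 / 2) / (d + 1))"
  have "mode_log s0 (d - s0) \<le> mean_log s0 (d - s0)
      + ((s0 - (d - s0)) / 2)\<^sup>2 / (d * (s0 + 1 / 2) * (d - s0 + 1 / 2))"
    using mode_log_le_mean_log[of s0 "d - s0"] pos by simp
  also have "(s0 - (d - s0)) / 2 = s0 - d / 2" by simp
  also have "mean_log s0 (d - s0) + (s0 - d / 2)\<^sup>2 / (d * (s0 + 1 / 2) * (d - s0 + 1 / 2))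
      \<le> mean_log s (d - s)"
    using mean_log_growth[of d s0 s] gap s0 s by linarith
  finally have "ln ?p \<le> ln ?q"
    using ln_bin_mass_mode[of s0 "d - s0"] ln_bin_mass_mean[of s "d - s"] pos by simp
  moreover have "?p > 0" "?q > 0"
    using pos by (auto intro!: mult_pos_pos bin_coeff_pos simp: bin_weight_def divide_simps)
  ultimately have "?p \<le> ?q" by simp
  then show ?thesis
    using Phi_le_mode[of s0 "d - s0"] Phi_ge_mean[of "d - s" s] pos by simp
qed

theorem theorem1p17:
  fixes d :: real
  assumes "d \<in> half_nats"
  shows "(d \<in> \<nat> \<longrightarrow>
            takes_min_at (Phi d) (admissible d) (d / 2) \<and> d - d / 2 = d / 2)
       \<and> (d \<notin> \<nat> \<longrightarrow>
            takes_min_at (Phi d) (admissible d) (d / 2 + 1 / 4)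
            \<and> d - (d / 2 + 1 / 4) = d / 2 - 1 / 4)"
proof (intro conjI impI)
  from assms obtain N :: nat where N: "N \<ge> 1" "d = real N / 2"
    by (auto simp: half_nats_def)
  show "takes_min_at (Phi d) (admissible d) (d / 2)" if "d \<in> \<nat>"
    unfolding takes_min_at_def
  proof (intro impI conjI ballI)
    assume "admissible d \<noteq> {}"
    moreover have "d / 2 \<in> half_nats"
    proof -
      from that obtain k where "d = real k" by (auto elim: Nats_cases)
      with N show ?thesis unfolding half_nats_def by (intro CollectI exI[of _ k]) auto
    qed
    ultimately show "d / 2 \<in> admissible d" by (auto simp: admissible_def)
  next
    fix s assume "s \<in> admissible d"
    then have s: "d / 2 \<le> s" "s < d - 1" by (auto simp: admissible_def)
    show "Phi d (d / 2) \<le> Phi d s"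
    proof (cases "s = d / 2")
      case False
      then show ?thesis using s by (intro Phi_le_PhiI) auto
    qed (simp only: order.refl)
  qed
  show "takes_min_at (Phi d) (admissible d) (d / 2 + 1 / 4)" if d: "d \<notin> \<nat>"
  proof -
    let ?s0 = "d / 2 + 1 / 4"
    have "odd N"
    proof
      assume "even N"
      then have "d = real (N div 2)" using N by (auto elim: evenE)
      with d show False by simp
    qed
    then obtain j where j: "N = 2 * j + 1" by (rule oddE)
    have s0: "?s0 = real (j + 1) / 2" using N j by (simp add: field_simps)
    \<comment> \<open>For odd \<open>N\<close> the point \<open>d / 2\<close> is a quarter away from the half-integers, which leaves \<open>?s0\<close> as the
      first admissible point.\<close>
    have s0_le: "s = ?s0 \<or> s \<ge> ?s0 + 1 / 2" if "s \<in> admissible d" for s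
    proof -
      from that obtain k where k: "s = real k / 2" "d / 2 \<le> s"
        by (auto simp: admissible_def half_nats_def)
      then have "k \<ge> j + 1" using N j by simp
      then consider "k = j + 1" | "k \<ge> j + 2" by linarith
      then show ?thesis unfolding s0 k(1) by cases (auto simp: field_simps)
    qed
    show ?thesis unfolding takes_min_at_def
    proof (intro impI conjI ballI)
      assume "admissible d \<noteq> {}"
      then obtain s where "s \<in> admissible d" by blast
      with s0_le[OF this] have "?s0 < d - 1" by (auto simp: admissible_def)
      moreover have "?s0 \<in> half_nats"
        unfolding half_nats_def s0 by (intro CollectI exI[of _ "j + 1"]) auto
      ultimately show "?s0 \<in> admissible d" by (auto simp: admissible_def)
    next
      fix s assume adm: "s \<in> admissible d"
      then have s: "d / 2 \<le> s" "s < d - 1" by (auto simp: admissible_def)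
      then have d1: "d > 1" by simp
      from s0_le[OF adm] show "Phi d ?s0 \<le> Phi d s"
      proof
        assume le: "s \<ge> ?s0 + 1 / 2"
        show ?thesis
        proof (rule Phi_le_PhiI)
          have "(?s0 - d / 2)\<^sup>2 / (d * (?s0 + 1 / 2) * (d - ?s0 + 1 / 2))
              = (1 / 16) / (d * (d\<^sup>2 / 4 + d / 2 + 3 / 16))"
            by (simp add: power2_eq_square algebra_simps)
          also have "\<dots> \<le> (1 / 16) / ((d + 1)\<^sup>2 / 16)"
          proof (intro divide_left_mono mult_pos_pos)
            have "(d + 1)\<^sup>2 / 16 \<le> 1 * (d\<^sup>2 / 4 + d / 2 + 3 / 16)"
              using d1 by (simp add: power2_eq_square field_simps)
            also have "\<dots> \<le> d * (d\<^sup>2 / 4 + d / 2 + 3 / 16)"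
              using d1 by (intro mult_right_mono) auto
            finally show "(d + 1)\<^sup>2 / 16 \<le> d * (d\<^sup>2 / 4 + d / 2 + 3 / 16)" .
          qed (use d1 in \<open>auto intro!: add_pos_pos\<close>)
          also have "\<dots> = 2 * ((3 / 4)\<^sup>2 - (1 / 4)\<^sup>2) / (d + 1)\<^sup>2"
            by (simp add: power2_eq_square)
          also have "\<dots> \<le> 2 * ((s - d / 2)\<^sup>2 - (?s0 - d / 2)\<^sup>2) / (d + 1)\<^sup>2"
          proof (intro divide_right_mono mult_left_mono diff_mono)
            show "(3 / 4)\<^sup>2 \<le> (s - d / 2)\<^sup>2" using le by (intro power_mono) auto
          qed auto
          finally show "(?s0 - d / 2)\<^sup>2 / (d * (?s0 + 1 / 2) * (d - ?s0 + 1 / 2))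
              \<le> 2 * ((s - d / 2)\<^sup>2 - (?s0 - d / 2)\<^sup>2) / (d + 1)\<^sup>2" .
        qed (use le s in auto)
      qed simp
    qed
  qed
qed auto

end
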